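(* $\mathfrak{M}_0 = \{\delta_{\mathbf{w},\mathfrak{v}} : \mathbf{w}=(w_n) \text{ a sequence in } \mathbb{D} \text{ with } \lim_{n\to\infty}|w_n|=1,\ \mathfrak{v}\in\beta\mathbb{N}\setminus\mathbb{N}\}$.
   Context: $\mathbb{K}$ is an algebraically closed field, complete with respect to a nontrivial nonarchimedean absolute value $|\cdot|$; $\mathbb{D} = \{z \in \mathbb{K} : |z|<1\}$; $\mathbb{N}=\{1,2,\dots\}$; $\beta\mathbb{N}\setminus\mathbb{N}$ is the set of nonprincipal ultrafilters in $\mathbb{N}$. $H^\infty$ is the Banach $\mathbb{K}$-algebra of bounded power series $f(z)=\sum_{n\ge 0} a_n z^n$ on $\mathbb{D}$, with norm $\|f\| = \sup_n |a_n| = \sup_{z\in\mathbb{D}}|f(z)|$. $\mathfrak{M}$ is the Berkovich space of $H^\infty$: the set of all maps $\varphi: H^\infty \to [0,\infty)$ with $\varphi(0)=0$, $\varphi(1)=1$, $\varphi(fg)=\varphi(f)\varphi(g)$, $\varphi(f+g)\le \varphi(f)+\varphi(g)$ and $\varphi(f)\le\|f\|$, with the topology of pointwise convergence (it is compact Hausdorff). $D^+(z,r)$ is the closed disk with center $z$ and radius $r$, and for a disk $D\subset\mathbb{D}$, $\zeta_D(f) := \sup_{z\in D}|f(z)|$, which is an element of $\mathfrak{M}$. For $z\in\mathbb{D}$, $\delta_z(f):=|f(z)|$, and $\delta_{\mathbf{w},\mathfrak{v}} := \lim_{\mathfrak{v}}\delta_{w_n}$ (pointwise limit along the ultrafilter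 $\mathfrak{v}$). $\mathfrak{M}_0$ is the set of all seminorms $\lim_{\mathfrak{u}} \zeta_{D^+(z_n,r_n)} \in \mathfrak{M}$ (pointwise limit along $\mathfrak{u}$), where $\mathfrak{u}$ is any nonprincipal ultrafilter in $\mathbb{N}$, $(z_n)$ is any sequence in $\mathbb{D}$ with $\lim_{n\to\infty}|z_n|=1$, and $(r_n)$ is any sequence in $(0,1)$. *)

theory Defs
  imports "HOL-Analysis.Analysis"
begin

text \<open>
  The library's \<open>norm\<close> is reserved for real normed spaces, hence a separate absolute value.
  Its nonnegativity and definiteness follow from the metric space axioms through \<open>dist_vabs\<close>.
\<close>

class complete_nonarch_field = alg_closed_field + complete_space +
  fixes vabs :: "'a \<Rightarrow> real"
  assumes dist_vabs: "dist x y = vabs (x - y)"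
    and vabs_mult: "vabs (x * y) = vabs x * vabs y"
    and vabs_add: "vabs (x + y) \<le> max (vabs x) (vabs y)"
    and vabs_nontrivial: "\<exists>x. x \<noteq> 0 \<and> vabs x \<noteq> 1"

definition unit_disk :: "'a::complete_nonarch_field set"  (\<open>\<bbbD>\<close>)
  where "\<bbbD> = {z. vabs z < 1}"

text \<open>
  Elements of the algebra are represented by their formal power series, whose product is the
  Cauchy product.  Boundedness is finiteness of the norm \<open>sup\<^sub>n |a\<^sub>n|\<close>.
\<close>

definition H_inf :: "'a::complete_nonarch_field fps set"  (\<open>H\<^sup>\<infinity>\<close>)
  where "H\<^sup>\<infinity> = {f. bdd_above (range (\<lambda>n. vabs (fps_nth f n)))}"

definition norm_H :: "'a::complete_nonarch_field fps \<Rightarrow> real"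
  where "norm_H f = (SUP n. vabs (fps_nth f n))"

definition eval_H :: "'a::complete_nonarch_field fps \<Rightarrow> 'a \<Rightarrow> 'a"
  where "eval_H f z = (\<Sum>n. fps_nth f n * z ^ n)"

text \<open>
  Maps on \<open>H\<^sup>\<infinity>\<close> are extensional functions (fixed to \<open>undefined\<close> outside \<open>H\<^sup>\<infinity>\<close>), so that two of
  them are equal if and only if they agree on \<open>H\<^sup>\<infinity>\<close>.
\<close>

definition berkovich :: "('a::complete_nonarch_field fps \<Rightarrow> real) set"  (\<open>\<MM>\<close>)
  where "\<MM> = {\<phi> \<in> H\<^sup>\<infinity> \<rightarrow>\<^sub>E {0..}.
    \<phi> 0 = 0 \<and> \<phi> 1 = 1 \<and>
    (\<forall>f\<in>H\<^sup>\<infinity>. \<forall>g\<in>H\<^sup>\<infinity>. \<phi> (f * g) = \<phi> f * \<phi> g) \<and>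
    (\<forall>f\<in>H\<^sup>\<infinity>. \<forall>g\<in>H\<^sup>\<infinity>. \<phi> (f + g) \<le> \<phi> f + \<phi> g) \<and>
    (\<forall>f\<in>H\<^sup>\<infinity>. \<phi> f \<le> norm_H f)}"

definition disk_seminorm :: "'a::complete_nonarch_field set \<Rightarrow> 'a fps \<Rightarrow> real"  (\<open>\<zeta>\<close>)
  where "\<zeta> D = (\<lambda>f\<in>H\<^sup>\<infinity>. SUP z\<in>D. vabs (eval_H f z))"

definition point_seminorm :: "'a::complete_nonarch_field \<Rightarrow> 'a fps \<Rightarrow> real"  (\<open>\<delta>\<close>)
  where "\<delta> z = (\<lambda>f\<in>H\<^sup>\<infinity>. vabs (eval_H f z))"

definition nonprincipal_ultrafilter :: "nat filter \<Rightarrow> bool"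
  where "nonprincipal_ultrafilter U \<longleftrightarrow>
    U \<noteq> bot \<and>
    (\<forall>P. eventually P U \<or> eventually (\<lambda>n. \<not> P n) U) \<and>
    (\<forall>m. \<not> eventually (\<lambda>n. n = m) U)"

text \<open>
  Pointwise limit along a filter.  For elements of \<open>\<MM>\<close> and an ultrafilter it exists, because the
  values at \<open>f\<close> lie in the compact interval from \<open>0\<close> to \<open>norm_H f\<close>.
\<close>

definition pointwise_lim ::
    "nat filter \<Rightarrow> (nat \<Rightarrow> 'a::complete_nonarch_field fps \<Rightarrow> real) \<Rightarrow> 'a fps \<Rightarrow> real"
  where "pointwise_lim U \<Phi> = (\<lambda>f\<in>H\<^sup>\<infinity>. Lim U (\<lambda>n. \<Phi> n f))"

definition point_seminorm_lim ::
    "(nat \<Rightarrow> 'a::complete_nonarch_field) \<Rightarrow> nat filter \<Rightarrow> 'a fps \<Rightarrow> real"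
  where "point_seminorm_lim w V = pointwise_lim V (\<lambda>n. \<delta> (w n))"

definition berkovich0 :: "('a::complete_nonarch_field fps \<Rightarrow> real) set"  (\<open>\<MM>\<^sub>0\<close>)
  where "\<MM>\<^sub>0 = {\<phi> \<in> \<MM>. \<exists>U z r.
    nonprincipal_ultrafilter U \<and>
    (\<forall>n. z n \<in> \<bbbD>) \<and> (\<lambda>n. vabs (z n)) \<longlonglongrightarrow> 1 \<and>
    (\<forall>n. 0 < r n \<and> r n < 1) \<and>
    \<phi> = pointwise_lim U (\<lambda>n. \<zeta> (cball (z n) (r n)))}"

end

theory Submission
  imports Defs "HOL-Real_Asymp.Real_Asymp"
begin

text \<open>
  One inclusion is soft: bounded power series are uniformly Lipschitz on the disk, so points may be
  replaced by disks around them whose radii tend to \<open>0\<close> (\<open>point_seminorm_lim_in_berkovich0\<close>).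

  For the other inclusion, let \<open>\<phi>\<close> be the limit along \<open>\<uu>\<close> of the seminorms of disks \<open>D\<^sub>n\<close> of radius
  \<open>r\<^sub>n\<close>.  A single point in each disk need not be generic for all \<open>f\<close> simultaneously, so each \<open>D\<^sub>n\<close>
  receives a finite column of \<open>K\<^sub>n\<close> points, any two of which are at distance almost \<open>r\<^sub>n\<close>; there is
  room for them because the residue field is infinite and the value group is dense
  (\<open>separated_points_in_disk\<close>).  Let \<open>\<phi> f > 0\<close>, as otherwise
  \<open>\<bar>f\<bar> \<le> \<zeta> D\<^sub>n f\<close> is enough, and suppose that \<open>\<bar>f\<bar>\<close> falls noticeably short of \<open>\<zeta> D\<^sub>n f\<close> at \<open>N\<close> points of
  the column.  Newton interpolation through these points approximates \<open>f\<close> on \<open>D\<^sub>n\<close> up to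
  \<open>r\<^sub>n\<^sup>N \<parallel>f\<parallel>\<close> and has constants near 1 (\<open>small_at_separated_points_imp_small\<close>).  Therefore
  \<open>r\<^sub>n\<^sup>N \<parallel>f\<parallel>\<close> cannot be small, and \<open>N\<close> is at most a constant depending on \<open>f\<close> times
  any \<open>L\<^sub>n\<close> with \<open>r\<^sub>n\<^bsup>L\<^sub>n\<^esup> \<le> 1/2\<close>.  The constant is uniform in \<open>n\<close>, which is what makes finite columns
  sufficient: with \<open>K\<^sub>n = (n + 1) L\<^sub>n\<close> the exceptional points of every \<open>f\<close> form a vanishing
  proportion of the columns.

  The sets of points with only \<open>O(L\<^sub>n)\<close> exceptions in the \<open>n\<close>-th column, for \<open>\<uu>\<close>-most \<open>n\<close>, form a
  proper filter (\<open>few_exceptions\<close>), along which \<open>\<bar>f\<bar>\<close> tends to \<open>\<phi> f\<close> for every \<open>f\<close>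
  (\<open>tendsto_few_exceptions\<close>).  Any ultrafilter refining it represents \<open>\<phi>\<close>.  Finiteness of the columns
  ensures that the points, enumerated in one sequence, still approach the boundary of the disk.
\<close>

section \<open>The absolute value\<close>

lemma vabs_eq_dist_0: "vabs x = dist x 0"
  by (simp add: dist_vabs)

lemma vabs_nonneg [simp]: "0 \<le> vabs x"
  by (simp add: vabs_eq_dist_0)

lemma vabs_eq_0_iff [simp]: "vabs x = 0 \<longleftrightarrow> x = 0"
  by (simp add: vabs_eq_dist_0)

lemma vabs_0 [simp]: "vabs 0 = 0"
  by simp

lemma vabs_1 [simp]: "vabs (1::'a::complete_nonarch_field) = 1"
  using vabs_mult[of "1::'a" 1] by simp

lemma vabs_minus [simp]: "vabs (- x) = vabs x"
  using dist_vabs[of 0 x] dist_vabs[of x 0] by (simp add: dist_commute)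

lemma vabs_minus_commute: "vabs (x - y) = vabs (y - x)"
  by (metis dist_vabs dist_commute)

lemma vabs_add_le: "vabs x \<le> a \<Longrightarrow> vabs y \<le> a \<Longrightarrow> vabs (x + y) \<le> a"
  using vabs_add[of x y] by linarith

lemma vabs_diff_le: "vabs x \<le> a \<Longrightarrow> vabs y \<le> a \<Longrightarrow> vabs (x - y) \<le> a"
  using vabs_add_le[of x a "- y"] by simp

lemma vabs_add_less: "vabs x < a \<Longrightarrow> vabs y < a \<Longrightarrow> vabs (x + y) < a"
  using vabs_add[of x y] by linarith

lemma vabs_diff_le_dist: "\<bar>vabs x - vabs y\<bar> \<le> vabs (x - y)"
  using abs_dist_diff_le[of x 0 y] by (simp add: dist_vabs)

lemma vabs_sum_le:
  assumes "0 \<le> a" "\<And>i. i \<in> A \<Longrightarrow> vabs (f i) \<le> a"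
  shows "vabs (sum f A) \<le> a"
  using assms by (induction A rule: infinite_finite_induct) (auto intro: vabs_add_le)

lemma vabs_power: "vabs (x ^ n) = vabs x ^ n"
  by (induction n) (simp_all add: vabs_mult)

lemma vabs_prod: "vabs (prod f A) = (\<Prod>i\<in>A. vabs (f i))"
  by (induction A rule: infinite_finite_induct) (simp_all add: vabs_mult)

lemma vabs_inverse: "vabs (inverse x) = inverse (vabs x)"
proof (cases "x = 0")
  case False
  then have "vabs x * vabs (inverse x) = 1"
    by (simp flip: vabs_mult)
  then show ?thesis
    by (metis inverse_unique)
qed simp

lemma vabs_power_int: "vabs (x powi n) = vabs x powi n"
  by (simp add: power_int_def vabs_power vabs_inverse)

text \<open>
  The isosceles property: the longer of two vectors determines the length of the sum.
\<close>

lemma vabs_add_eq_left: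
  assumes "vabs y < vabs x"
  shows "vabs (x + y) = vabs x"
  using vabs_add[of x y] vabs_add[of "x + y" "- y"] assms by auto

text \<open>
  The value group is dense in the positive reals: it contains numbers above 1 that are arbitrarily
  close to 1, namely the absolute values of the roots of any element of absolute value above 1.
\<close>

lemma value_group_dense:
  fixes s r :: real
  assumes "0 < s" "s < r"
  obtains a :: "'a::complete_nonarch_field" where "s \<le> vabs a" "vabs a \<le> r"
proof -
  obtain x :: 'a where x: "x \<noteq> 0" "vabs x \<noteq> 1"
    using vabs_nontrivial by blast
  obtain y :: 'a where y: "1 < vabs y"
  proof (cases "vabs x > 1")
    case False
    then have "vabs x < 1" "0 < vabs x"
      using x by (auto simp: less_le)
    then have "1 < vabs (inverse x)"
      by (simp add: vabs_inverse one_less_inverse)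
    then show ?thesis by (rule that)
  qed (rule that)
  obtain n where n: "vabs y < (r / s) ^ n"
    using real_arch_pow[of "r / s" "vabs y"] assms by auto
  have n0: "n > 0"
    using n y by (cases n) auto
  obtain t where t: "t ^ n = y"
    using nth_root_exists[OF n0, of y] by blast
  have tn: "vabs t ^ n = vabs y"
    using t vabs_power by metis
  have t1: "1 < vabs t"
  proof (rule ccontr)
    assume "\<not> 1 < vabs t"
    then have "vabs t ^ n \<le> 1"
      by (intro power_le_one) auto
    then show False using tn y by simp
  qed
  have t2: "vabs t < r / s"
  proof (rule ccontr)
    assume "\<not> vabs t < r / s"
    then have "(r / s) ^ n \<le> vabs t ^ n"
      using assms by (intro power_mono) auto
    then show False using tn n by simp
  qed
  define j where "j = \<lfloor>log (vabs t) r\<rfloor>"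
  have pw: "vabs t powr real_of_int j = vabs t powi j"
    using t1 by (intro powr_real_of_int' disjI1) linarith+
  have "vabs t powr real_of_int j \<le> vabs t powr log (vabs t) r"
    using t1 by (intro powr_mono) (auto simp: j_def)
  then have up: "vabs t powi j \<le> r"
    using t1 assms by (simp add: pw)
  have "vabs t powr log (vabs t) r \<le> vabs t powr (real_of_int j + 1)"
    using t1 by (intro powr_mono) (auto simp: j_def)
  then have "r \<le> vabs t powi j * vabs t"
    using t1 assms by (simp add: powr_add pw)
  also have "\<dots> \<le> vabs t powi j * (r / s)"
    using t1 t2 by (intro mult_left_mono) auto
  finally have "s \<le> vabs t powi j"
    using assms by (simp add: field_simps)
  then show ?thesis
    using that[of "t powi j"] up by (simp add: vabs_power_int)
qed

text \<open>
  The residue field is infinite.  Given finitely many points \<open>v\<close> of the closed unit disk, a root \<open>x\<close>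
  of \<open>1 + \<Prod> (X - v)\<close> has \<open>\<Prod> \<bar>x - v\<bar> = 1\<close>; this forces \<open>x\<close> into the closed unit disk, so that no
  factor exceeds 1, and therefore every factor equals 1.
\<close>

lemma new_residue_class:
  fixes A :: "'a::complete_nonarch_field set"
  assumes "finite A" "A \<noteq> {}" "\<And>v. v \<in> A \<Longrightarrow> vabs v \<le> 1"
  obtains x where "vabs x \<le> 1" "\<And>v. v \<in> A \<Longrightarrow> vabs (x - v) = 1"
proof -
  define q where "q = (\<Prod>v\<in>A. [:- v, 1:])"
  have degq: "degree q = card A"
    unfolding q_def by (subst degree_prod_eq_sum_degree) auto
  have "degree (q + 1) > 0"
    using degq assms by (simp add: degree_add_eq_left card_gt_0_iff)
  then obtain x where x: "poly (q + 1) x = 0"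
    using alg_closed_imp_poly_has_root by blast
  have "(\<Prod>v\<in>A. x - v) = - 1"
    using x by (simp add: q_def poly_prod add_eq_0_iff2)
  then have prod1: "(\<Prod>v\<in>A. vabs (x - v)) = 1"
    by (metis vabs_prod vabs_minus vabs_1)
  have x1: "vabs x \<le> 1"
  proof (rule ccontr)
    assume neg: "\<not> vabs x \<le> 1"
    have "vabs (x - v) = vabs x" if "v \<in> A" for v
      using vabs_add_eq_left[of "- v" x] assms(3)[OF that] neg by simp
    then have "(\<Prod>v\<in>A. vabs (x - v)) = vabs x ^ card A"
      by simp
    moreover have "1 < vabs x ^ card A"
      using neg assms by (intro one_less_power) (auto simp: card_gt_0_iff)
    ultimately show False using prod1 by simp
  qed
  have le: "vabs (x - v) \<le> 1" if "v \<in> A" for v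
    using vabs_diff_le[OF x1 assms(3)[OF that]] .
  have "vabs (x - v) = 1" if v: "v \<in> A" for v
  proof -
    have "1 = vabs (x - v) * (\<Prod>v\<in>A - {v}. vabs (x - v))"
      using prod1 prod.remove[OF assms(1) v, of "\<lambda>v. vabs (x - v)"] by simp
    also have "\<dots> \<le> vabs (x - v) * 1"
      using le by (intro mult_left_mono prod_le_1) auto
    finally show ?thesis using le[OF v] by simp
  qed
  then show ?thesis using that x1 by blast
qed

lemma separated_units:
  "\<exists>u :: nat \<Rightarrow> 'a::complete_nonarch_field.
    (\<forall>i<K. vabs (u i) = 1) \<and> (\<forall>i<K. \<forall>j<i. vabs (u i - u j) = 1)"
proof (induction K)
  case (Suc K)
  then obtain u :: "nat \<Rightarrow> 'a" where u: "\<And>i. i < K \<Longrightarrow> vabs (u i) = 1"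
    "\<And>i j. i < K \<Longrightarrow> j < i \<Longrightarrow> vabs (u i - u j) = 1"
    by blast
  \<comment> \<open>Including \<open>0\<close> among the points to be avoided makes the new point a unit.\<close>
  obtain x where x: "\<And>v. v \<in> insert 0 (u ` {..<K}) \<Longrightarrow> vabs (x - v) = 1"
  proof (rule new_residue_class[of "insert 0 (u ` {..<K})"])
    show "vabs v \<le> 1" if "v \<in> insert 0 (u ` {..<K})" for v
      using that u(1) by auto
  qed auto
  have "vabs x = 1"
    using x[of 0] by simp
  then have "(\<forall>i<Suc K. vabs ((u(K := x)) i) = 1) \<and>
    (\<forall>i<Suc K. \<forall>j<i. vabs ((u(K := x)) i - (u(K := x)) j) = 1)"
    using u x by (auto simp: less_Suc_eq)
  then show ?case by blast
qed simp

text \<open>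
  The units of the preceding lemma are scaled by an element whose absolute value lies between
  \<open>\<rho> * r\<close> and \<open>r\<close>.  The bound
  \<open>\<rho> * vabs z\<close> from below is what later drives the points to the boundary of the unit disk.
\<close>

lemma separated_points_in_disk:
  fixes z :: "'a::complete_nonarch_field"
  assumes "vabs z < 1" "0 < r" "r < 1" "0 < \<rho>" "\<rho> < 1"
  obtains p :: "nat \<Rightarrow> 'a" where
    "\<And>i. i < K \<Longrightarrow> vabs (p i - z) \<le> r" "\<And>i. i < K \<Longrightarrow> vabs (p i) < 1"
    "\<And>i. i < K \<Longrightarrow> \<rho> * vabs z \<le> vabs (p i)"
    "\<And>i j. i < K \<Longrightarrow> j < K \<Longrightarrow> i \<noteq> j \<Longrightarrow> \<rho> * r \<le> vabs (p i - p j)"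
proof -
  obtain a :: 'a where a: "\<rho> * r \<le> vabs a" "vabs a \<le> r"
    using value_group_dense[of "\<rho> * r" r] assms by auto
  obtain u :: "nat \<Rightarrow> 'a" where
    "(\<forall>i<K. vabs (u i) = 1) \<and> (\<forall>i<K. \<forall>j<i. vabs (u i - u j) = 1)"
    using separated_units[of K] by (elim exE)
  then have u: "\<And>i. i < K \<Longrightarrow> vabs (u i) = 1"
    "\<And>i j. i < K \<Longrightarrow> j < i \<Longrightarrow> vabs (u i - u j) = 1"
    by simp_all
  have sep: "vabs (u i - u j) = 1" if "i < K" "j < K" "i \<noteq> j" for i j
    using u(2)[of i j] u(2)[of j i] that vabs_minus_commute[of "u i" "u j"]
    by (metis linorder_neqE_nat)
  \<comment> \<open>A disk that contains \<open>0\<close> is recentred there, which keeps the points away from \<open>0\<close>.\<close>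
  define c where "c = (if r < vabs z then z else 0)"
  define p where "p i = c + a * u i" for i
  have au: "vabs (a * u i) = vabs a" if "i < K" for i
    using u(1)[OF that] by (simp add: vabs_mult)
  have cz: "vabs (c - z) \<le> r"
    using assms by (auto simp: c_def)
  show ?thesis
  proof (rule that[of p])
    fix i assume i: "i < K"
    have "vabs ((c - z) + a * u i) \<le> r"
      using cz au[OF i] a by (intro vabs_add_le) auto
    then show "vabs (p i - z) \<le> r"
      by (simp add: p_def algebra_simps)
    show "vabs (p i) < 1"
      unfolding p_def using au[OF i] a assms by (intro vabs_add_less) (auto simp: c_def)
    show "\<rho> * vabs z \<le> vabs (p i)"
    proof (cases "r < vabs z")
      case True
      then have "vabs (p i) = vabs z"
        unfolding p_def c_def using au[OF i] a by (simp add: vabs_add_eq_left)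
      then show ?thesis using assms by (simp add: mult_left_le_one_le)
    next
      case False
      then have "vabs (p i) = vabs a"
        using au[OF i] by (simp add: p_def c_def)
      moreover have "\<rho> * vabs z \<le> \<rho> * r"
        using False assms by (intro mult_left_mono) auto
      ultimately show ?thesis using a by linarith
    qed
  next
    fix i j assume ij: "i < K" "j < K" "i \<noteq> j"
    have "p i - p j = a * (u i - u j)"
      by (simp add: p_def algebra_simps)
    then show "\<rho> * r \<le> vabs (p i - p j)"
      using sep[OF ij] a by (simp add: vabs_mult)
  qed
qed


section \<open>Evaluation of bounded power series\<close>

text \<open>
  The estimates below pass one bound \<open>M\<close> on from a series to its shifts and quotients, without
  reference to the exact norms of these.
\<close>

definition coeff_bound :: "'a::complete_nonarch_field fps \<Rightarrow> real \<Rightarrow> bool"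
  where "coeff_bound f M \<longleftrightarrow> (\<forall>n. vabs (fps_nth f n) \<le> M)"

lemma H_inf_iff_coeff_bound: "f \<in> H\<^sup>\<infinity> \<longleftrightarrow> (\<exists>M. coeff_bound f M)"
  by (auto simp: H_inf_def coeff_bound_def bdd_above_def)

lemma coeff_bound_nonneg: "coeff_bound f M \<Longrightarrow> 0 \<le> M"
  unfolding coeff_bound_def using vabs_nonneg order_trans by blast

lemma coeff_bound_norm_H: "f \<in> H\<^sup>\<infinity> \<Longrightarrow> coeff_bound f (norm_H f)"
  unfolding coeff_bound_def norm_H_def H_inf_def by (auto intro: cSUP_upper)

lemma coeff_bound_mono: "coeff_bound f M \<Longrightarrow> M \<le> N \<Longrightarrow> coeff_bound f N"
  unfolding coeff_bound_def by (meson order_trans)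

lemma coeff_bound_add: "coeff_bound f M \<Longrightarrow> coeff_bound g M \<Longrightarrow> coeff_bound (f + g) M"
  unfolding coeff_bound_def by (simp add: vabs_add_le)

lemma coeff_bound_mult:
  assumes "coeff_bound f M" "coeff_bound g N"
  shows "coeff_bound (f * g) (M * N)"
  using assms coeff_bound_nonneg[OF assms(1)] coeff_bound_nonneg[OF assms(2)]
  by (auto simp: coeff_bound_def fps_mult_nth vabs_mult intro!: vabs_sum_le mult_mono)

lemma coeff_bound_const: "coeff_bound (fps_const c) (vabs c)"
  by (auto simp: coeff_bound_def)

lemma coeff_bound_shift: "coeff_bound f M \<Longrightarrow> coeff_bound (fps_shift k f) M"
  by (simp add: coeff_bound_def)

lemma H_inf_add: "f \<in> H\<^sup>\<infinity> \<Longrightarrow> g \<in> H\<^sup>\<infinity> \<Longrightarrow> f + g \<in> H\<^sup>\<infinity>"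
  by (metis H_inf_iff_coeff_bound coeff_bound_add coeff_bound_mono max.cobounded1 max.cobounded2)

lemma H_inf_mult: "f \<in> H\<^sup>\<infinity> \<Longrightarrow> g \<in> H\<^sup>\<infinity> \<Longrightarrow> f * g \<in> H\<^sup>\<infinity>"
  using H_inf_iff_coeff_bound coeff_bound_mult by metis

lemma H_inf_const: "fps_const c \<in> H\<^sup>\<infinity>"
  using H_inf_iff_coeff_bound coeff_bound_const by blast

lemma H_inf_X: "fps_X \<in> H\<^sup>\<infinity>"
  unfolding H_inf_iff_coeff_bound coeff_bound_def
  by (intro exI[of _ 1]) (simp add: fps_X_nth)

lemma H_inf_0: "0 \<in> H\<^sup>\<infinity>"
  using H_inf_const[of 0] by simp

lemma H_inf_1: "1 \<in> H\<^sup>\<infinity>"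
  using H_inf_const[of 1] by simp

lemma H_inf_uminus: "f \<in> H\<^sup>\<infinity> \<Longrightarrow> - f \<in> H\<^sup>\<infinity>"
  by (simp add: H_inf_iff_coeff_bound coeff_bound_def)

lemma H_inf_diff: "f \<in> H\<^sup>\<infinity> \<Longrightarrow> g \<in> H\<^sup>\<infinity> \<Longrightarrow> f - g \<in> H\<^sup>\<infinity>"
  using H_inf_add[of f "- g"] by (simp add: H_inf_uminus)

text \<open>
  In a complete nonarchimedean field a series converges as soon as its terms tend to \<open>0\<close>.
\<close>

lemma eval_H_sums:
  fixes f :: "'a::complete_nonarch_field fps"
  assumes f: "coeff_bound f M" and z: "vabs z < 1"
  shows "(\<lambda>n. fps_nth f n * z ^ n) sums eval_H f z"
proof -
  define S where "S N = (\<Sum>n<N. fps_nth f n * z ^ n)" for N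
  have M: "0 \<le> M" using coeff_bound_nonneg[OF f] .
  have tail: "vabs (S m - S N) \<le> M * vabs z ^ N" if "N \<le> m" for m N
  proof -
    have "S m - S N = (\<Sum>n\<in>{..<m} - {..<N}. fps_nth f n * z ^ n)"
      unfolding S_def using that by (subst sum_diff) auto
    also have "vabs \<dots> \<le> M * vabs z ^ N"
    proof (rule vabs_sum_le)
      fix n assume "n \<in> {..<m} - {..<N}"
      then have "vabs z ^ n \<le> vabs z ^ N"
        using z by (intro power_decreasing) auto
      then show "vabs (fps_nth f n * z ^ n) \<le> M * vabs z ^ N"
        using f M by (auto simp: vabs_mult vabs_power coeff_bound_def intro!: mult_mono)
    qed (use M in auto)
    finally show ?thesis .
  qed
  have "(\<lambda>N. M * vabs z ^ N) \<longlonglongrightarrow> M * 0"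
    using z by (intro tendsto_mult tendsto_const LIMSEQ_realpow_zero) auto
  then have lim0: "(\<lambda>N. M * vabs z ^ N) \<longlonglongrightarrow> 0" by simp
  have "Cauchy S"
  proof (rule metric_CauchyI)
    fix e :: real assume "0 < e"
    then obtain N where N: "M * vabs z ^ N < e"
      using eventually_happens'[OF sequentially_bot order_tendstoD(2)[OF lim0, of e]] by auto
    have "dist (S m) (S n) < e" if "N \<le> m" "N \<le> n" for m n
    proof -
      have "vabs ((S m - S N) - (S n - S N)) \<le> M * vabs z ^ N"
        using that by (intro vabs_diff_le[OF tail tail])
      then show ?thesis using N by (simp add: dist_vabs)
    qed
    then show "\<exists>N. \<forall>m\<ge>N. \<forall>n\<ge>N. dist (S m) (S n) < e" by blast
  qed
  then obtain l where "S \<longlonglongrightarrow> l"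
    using Cauchy_convergent convergent_def by blast
  then have "(\<lambda>n. fps_nth f n * z ^ n) sums l"
    unfolding sums_def S_def .
  then show ?thesis
    unfolding eval_H_def by (simp add: sums_iff)
qed

lemma vabs_eval_H_le:
  fixes f :: "'a::complete_nonarch_field fps"
  assumes f: "coeff_bound f M" and z: "vabs z < 1"
  shows "vabs (eval_H f z) \<le> M"
proof -
  have M: "0 \<le> M" using coeff_bound_nonneg[OF f] .
  have "(\<lambda>N. dist (\<Sum>n<N. fps_nth f n * z ^ n) 0) \<longlonglongrightarrow> dist (eval_H f z) 0"
    using eval_H_sums[OF f z] unfolding sums_def by (intro tendsto_dist tendsto_const)
  moreover have "dist (\<Sum>n<N. fps_nth f n * z ^ n) 0 \<le> M" for N
  proof -
    have "vabs (fps_nth f n * z ^ n) \<le> M * 1" for n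
      using f M z unfolding vabs_mult vabs_power coeff_bound_def
      by (intro mult_mono power_le_one) auto
    then show ?thesis
      unfolding vabs_eq_dist_0[symmetric] using M by (intro vabs_sum_le) auto
  qed
  ultimately show ?thesis
    unfolding vabs_eq_dist_0 by (intro LIMSEQ_le_const2) auto
qed

lemma eval_H_shift:
  fixes f :: "'a::complete_nonarch_field fps"
  assumes f: "coeff_bound f M" and z: "vabs z < 1"
  shows "eval_H f z = fps_nth f 0 + z * eval_H (fps_shift 1 f) z"
proof -
  define T where "T N = (\<Sum>n<N. fps_nth (fps_shift 1 f) n * z ^ n)" for N
  define l where "l = eval_H (fps_shift 1 f) z"
  have "T \<longlonglongrightarrow> l"
    using eval_H_sums[OF coeff_bound_shift[OF f] z] unfolding sums_def T_def l_def .
  then have T: "(\<lambda>N. dist (T N) l) \<longlonglongrightarrow> 0"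
    by (simp flip: tendsto_dist_iff)
  have S: "(\<Sum>n<Suc N. fps_nth f n * z ^ n) = fps_nth f 0 + z * T N" for N
    unfolding T_def sum.lessThan_Suc_shift by (simp add: sum_distrib_left mult_ac)
  have "dist (fps_nth f 0 + z * T N) (fps_nth f 0 + z * l) = vabs z * dist (T N) l" for N
    by (simp add: dist_vabs flip: vabs_mult right_diff_distrib)
  then have "(\<lambda>N. dist (fps_nth f 0 + z * T N) (fps_nth f 0 + z * l)) \<longlonglongrightarrow> 0"
    using tendsto_mult[OF tendsto_const[of "vabs z"] T] by simp
  then have "(\<lambda>N. \<Sum>n<Suc N. fps_nth f n * z ^ n) \<longlonglongrightarrow> fps_nth f 0 + z * l"
    unfolding S by (simp flip: tendsto_dist_iff)
  moreover have "(\<lambda>N. \<Sum>n<Suc N. fps_nth f n * z ^ n) \<longlonglongrightarrow> eval_H f z"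
    using eval_H_sums[OF f z] unfolding sums_def by (rule LIMSEQ_Suc)
  ultimately show ?thesis
    unfolding l_def using LIMSEQ_unique by blast
qed

text \<open>
  Division by \<open>X - w\<close> with remainder.  The quotient is found by synthetic division: its \<open>n\<close>-th
  coefficient is the sum of \<open>f\<^sub>m w\<^bsup>m-n-1\<^esup>\<close> over \<open>m > n\<close>, which is the value at \<open>w\<close> of a shift of \<open>f\<close>.
  That the quotient obeys the same coefficient bound as \<open>f\<close> is special to the nonarchimedean setting.
\<close>

lemma fps_divide_linear:
  fixes f :: "'a::complete_nonarch_field fps"
  assumes f: "coeff_bound f M" and w: "vabs w < 1"
  obtains g where "coeff_bound g M" "f = fps_const (eval_H f w) + (fps_X - fps_const w) * g"
proof -
  define g where "g = Abs_fps (\<lambda>n. eval_H (fps_shift (Suc n) f) w)"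
  have g: "fps_nth f n + w * fps_nth g n = eval_H (fps_shift n f) w" for n
  proof -
    have "fps_shift 1 (fps_shift n f) = fps_shift (Suc n) f"
      by (simp add: fps_ext)
    then show ?thesis
      using eval_H_shift[OF coeff_bound_shift[OF f] w, of n] by (simp add: g_def)
  qed
  have "coeff_bound g M"
    unfolding coeff_bound_def g_def using vabs_eval_H_le[OF coeff_bound_shift[OF f] w] by simp
  moreover have "f = fps_const (eval_H f w) + (fps_X - fps_const w) * g"
  proof (rule fps_ext)
    fix n
    show "fps_nth f n = fps_nth (fps_const (eval_H f w) + (fps_X - fps_const w) * g) n"
    proof (cases n)
      case 0
      then show ?thesis using g[of 0] by (simp add: algebra_simps)
    next
      case (Suc m)
      have "fps_nth g m = eval_H (fps_shift n f) w"
        by (simp add: g_def Suc)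
      then show ?thesis using g[of n] Suc by (simp add: algebra_simps)
    qed
  qed
  ultimately show ?thesis using that by blast
qed

text \<open>
  The value at \<open>w\<close> is the only possible remainder: if \<open>(X - w) g\<close> is constant, then
  \<open>g\<^sub>0 = w\<^sup>n g\<^sub>n\<close> for all \<open>n\<close>, which tends to \<open>0\<close>.  This characterises evaluation algebraically, and
  its homomorphism properties follow without any manipulation of series.
\<close>

lemma eval_H_unique:
  fixes f :: "'a::complete_nonarch_field fps"
  assumes w: "vabs w < 1" and g: "g \<in> H\<^sup>\<infinity>"
    and fg: "f = fps_const c + (fps_X - fps_const w) * g"
  shows "eval_H f w = c"
proof -
  have "f \<in> H\<^sup>\<infinity>"
    unfolding fg by (intro H_inf_add H_inf_mult H_inf_diff H_inf_X H_inf_const g)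
  then obtain M where "coeff_bound f M"
    using H_inf_iff_coeff_bound by blast
  then obtain h where h: "coeff_bound h M"
    and fh: "f = fps_const (eval_H f w) + (fps_X - fps_const w) * h"
    using fps_divide_linear[OF _ w] by blast
  define q where "q = h - g"
  define d where "d = c - eval_H f w"
  have "q \<in> H\<^sup>\<infinity>"
    unfolding q_def using h g H_inf_iff_coeff_bound by (intro H_inf_diff) auto
  then obtain N where N: "coeff_bound q N"
    using H_inf_iff_coeff_bound by blast
  have dq: "fps_const d = (fps_X - fps_const w) * q"
  proof -
    have "fps_const c + (fps_X - fps_const w) * g
        = fps_const (eval_H f w) + (fps_X - fps_const w) * h"
      using fg fh by metis
    moreover have "a - b = y - x" if "a + x = b + y" for a b x y :: "'a fps"
      using that by (simp add: algebra_simps)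
    ultimately have "fps_const c - fps_const (eval_H f w)
        = (fps_X - fps_const w) * h - (fps_X - fps_const w) * g"
      by blast
    then show ?thesis
      unfolding d_def q_def by (simp add: right_diff_distrib)
  qed
  have "fps_nth q 0 = w ^ n * fps_nth q n" for n
  proof (induction n)
    case (Suc n)
    have "0 = fps_nth q n - w * fps_nth q (Suc n)"
      using arg_cong[OF dq, of "\<lambda>s. fps_nth s (Suc n)"] by (simp add: algebra_simps)
    then show ?case using Suc by (simp add: algebra_simps)
  qed simp
  then have "vabs (fps_nth q 0) \<le> vabs w ^ n * N" for n
    using N unfolding coeff_bound_def
    by (metis mult_left_mono vabs_mult vabs_nonneg vabs_power zero_le_power)
  moreover have "(\<lambda>n. vabs w ^ n * N) \<longlonglongrightarrow> 0 * N"
    using w by (intro tendsto_mult tendsto_const LIMSEQ_realpow_zero) auto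
  ultimately have "vabs (fps_nth q 0) \<le> 0"
    by (intro LIMSEQ_le_const) auto
  then have "fps_nth q 0 = 0"
    by (metis vabs_nonneg vabs_eq_0_iff order_antisym)
  then have "d = 0"
    using arg_cong[OF dq, of "\<lambda>s. fps_nth s 0"] by (simp add: algebra_simps)
  then show ?thesis by (simp add: d_def)
qed

lemma eval_H_const: "vabs w < 1 \<Longrightarrow> eval_H (fps_const c) w = c"
  using eval_H_unique[of w 0 "fps_const c" c] H_inf_0 by simp

lemma eval_H_add_mult:
  fixes f g :: "'a::complete_nonarch_field fps"
  assumes w: "vabs w < 1" and "f \<in> H\<^sup>\<infinity>" "g \<in> H\<^sup>\<infinity>"
  shows eval_H_add: "eval_H (f + g) w = eval_H f w + eval_H g w"
    and eval_H_mult: "eval_H (f * g) w = eval_H f w * eval_H g w"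
proof -
  define Y where "Y = fps_X - fps_const w"
  obtain f1 where f1: "f1 \<in> H\<^sup>\<infinity>" "f = fps_const (eval_H f w) + Y * f1"
    using fps_divide_linear[OF _ w] assms(2) H_inf_iff_coeff_bound unfolding Y_def by metis
  obtain g1 where g1: "g1 \<in> H\<^sup>\<infinity>" "g = fps_const (eval_H g w) + Y * g1"
    using fps_divide_linear[OF _ w] assms(3) H_inf_iff_coeff_bound unfolding Y_def by metis
  define a b where "a = fps_const (eval_H f w)" and "b = fps_const (eval_H g w)"
  have "f + g = (a + b) + Y * (f1 + g1)"
    using f1(2) g1(2) unfolding a_def[symmetric] b_def[symmetric]
    by (metis (no_types, lifting) add.assoc add.left_commute distrib_left)
  then show "eval_H (f + g) w = eval_H f w + eval_H g w"
    using eval_H_unique[OF w H_inf_add[OF f1(1) g1(1)]] unfolding Y_def a_def b_def by simp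
  have "f * g = a * g + Y * (f1 * g)"
    using f1(2) unfolding a_def[symmetric] by (metis distrib_right mult.assoc)
  also have "a * g = a * b + Y * (a * g1)"
    using g1(2) unfolding b_def[symmetric] by (metis distrib_left mult.left_commute)
  finally have "f * g = a * b + Y * (a * g1 + f1 * g)"
    by (simp add: distrib_left)
  moreover have "a * g1 + f1 * g \<in> H\<^sup>\<infinity>"
    unfolding a_def by (intro H_inf_add H_inf_mult H_inf_const f1 g1 assms)
  ultimately show "eval_H (f * g) w = eval_H f w * eval_H g w"
    using eval_H_unique[OF w] unfolding Y_def a_def b_def by simp
qed

lemma eval_H_divided_difference:
  fixes f :: "'a::complete_nonarch_field fps"
  assumes f: "coeff_bound f M" and w: "vabs w < 1"
  obtains g where "coeff_bound g M"
    "\<And>x. vabs x < 1 \<Longrightarrow> eval_H f x = eval_H f w + (x - w) * eval_H g x"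
proof -
  obtain g where g: "coeff_bound g M"
    and fg: "f = fps_const (eval_H f w) + (fps_X - fps_const w) * g"
    using fps_divide_linear[OF f w] by blast
  have g': "g \<in> H\<^sup>\<infinity>" using g H_inf_iff_coeff_bound by blast
  have "eval_H f x = eval_H f w + (x - w) * eval_H g x" if x: "vabs x < 1" for x
  proof -
    have Xw: "eval_H (fps_X - fps_const w) x = x - w"
    proof (rule eval_H_unique[OF x H_inf_1])
      show "fps_X - fps_const w = fps_const (x - w) + (fps_X - fps_const x) * 1"
        unfolding fps_const_sub[symmetric] by simp
    qed
    have "eval_H (fps_const (eval_H f w) + (fps_X - fps_const w) * g) x
        = eval_H f w + (x - w) * eval_H g x"
      using x g'
      by (simp add: H_inf_X eval_H_add eval_H_mult eval_H_const Xw H_inf_mult H_inf_const H_inf_diff)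
    then show ?thesis using fg by metis
  qed
  then show ?thesis using that g by blast
qed

lemma eval_H_lipschitz:
  fixes f :: "'a::complete_nonarch_field fps"
  assumes f: "coeff_bound f M" and x: "vabs x < 1" and w: "vabs w < 1"
  shows "vabs (eval_H f x - eval_H f w) \<le> M * vabs (x - w)"
proof -
  obtain g where g: "coeff_bound g M"
    "eval_H f x = eval_H f w + (x - w) * eval_H g x"
    using eval_H_divided_difference[OF f w] x by blast
  then have "vabs (eval_H f x - eval_H f w) = vabs (x - w) * vabs (eval_H g x)"
    by (simp add: vabs_mult)
  also have "\<dots> \<le> vabs (x - w) * M"
    using vabs_eval_H_le[OF g(1) x] by (intro mult_left_mono) auto
  finally show ?thesis by (simp add: mult.commute)
qed

text \<open>
  A quantitative identity principle: a bounded power series that is small at many separated points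
  of a disk is small on the whole disk.  Newton interpolation proves it, peeling off one node at a
  time: the divided difference at a node is bounded by \<open>M\<close> again, and its values at the other nodes
  grow by a factor of at most \<open>1/s\<close>.
\<close>

lemma small_at_separated_points_imp_small:
  fixes f :: "'a::complete_nonarch_field fps"
  assumes "finite T" and f: "coeff_bound f M" and s: "0 < s" "s \<le> r" and \<eta>: "0 \<le> \<eta>"
    and T: "\<And>t. t \<in> T \<Longrightarrow> vabs t < 1"
    and x: "vabs x < 1" "\<And>t. t \<in> T \<Longrightarrow> vabs (x - t) \<le> r"
    and sep: "\<And>t t'. t \<in> T \<Longrightarrow> t' \<in> T \<Longrightarrow> t \<noteq> t' \<Longrightarrow> s \<le> vabs (t - t')"
    and small: "\<And>t. t \<in> T \<Longrightarrow> vabs (eval_H f t) \<le> \<eta>"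
  shows "vabs (eval_H f x) \<le> max ((r / s) ^ card T * \<eta>) (r ^ card T * M)"
  using assms(1) f \<eta> T x(2) sep small
proof (induction T arbitrary: f \<eta> rule: finite_induct)
  case empty
  then show ?case using vabs_eval_H_le[OF _ x(1), of f M] by simp
next
  case (insert w T)
  have w: "vabs w < 1" using insert.prems by simp
  obtain g where g: "coeff_bound g M"
    "\<And>x. vabs x < 1 \<Longrightarrow> eval_H f x = eval_H f w + (x - w) * eval_H g x"
    using eval_H_divided_difference[OF insert.prems(1) w] by blast
  have gT: "vabs (eval_H g t) \<le> \<eta> / s" if t: "t \<in> T" for t
  proof -
    have st: "s \<le> vabs (t - w)" using insert.prems(5)[of t w] insert.hyps(2) t by auto
    have "(t - w) * eval_H g t = eval_H f t - eval_H f w"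
      using g(2)[of t] insert.prems t by simp
    then have "vabs (t - w) * vabs (eval_H g t) = vabs (eval_H f t - eval_H f w)"
      by (metis vabs_mult)
    also have "\<dots> \<le> \<eta>"
      using insert.prems t by (intro vabs_diff_le) auto
    finally have "s * vabs (eval_H g t) \<le> \<eta>"
      using mult_right_mono[OF st, of "vabs (eval_H g t)"] by simp
    then show ?thesis using s by (simp add: field_simps)
  qed
  have IH: "vabs (eval_H g x) \<le> max ((r / s) ^ card T * (\<eta> / s)) (r ^ card T * M)"
    using insert.prems s gT g(1) by (intro insert.IH) auto
  have r: "0 < r" using s by simp
  let ?B = "max ((r / s) ^ card (insert w T) * \<eta>) (r ^ card (insert w T) * M)"
  have "vabs (x - w) * vabs (eval_H g x)
      \<le> r * max ((r / s) ^ card T * (\<eta> / s)) (r ^ card T * M)"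
    using IH r insert.prems by (intro mult_mono) auto
  also have "\<dots> = ?B"
    using insert.hyps r by (simp add: max_mult_distrib_left mult_ac)
  finally have 1: "vabs ((x - w) * eval_H g x) \<le> ?B"
    by (simp add: vabs_mult)
  have "1 * \<eta> \<le> (r / s) ^ card (insert w T) * \<eta>"
    using s insert.prems by (intro mult_right_mono one_le_power) auto
  then have 2: "vabs (eval_H f w) \<le> ?B"
    using insert.prems(6)[of w] by simp
  show ?case
    unfolding g(2)[OF x(1)] using 2 1 by (rule vabs_add_le)
qed


section \<open>Seminorms of disks\<close>

lemma disk_seminorm_props:
  fixes f :: "'a::complete_nonarch_field fps"
  assumes f: "coeff_bound f M" and z: "vabs z < 1" and r: "0 < r" "r < 1"
  shows vabs_eval_le_disk_seminorm: "vabs (x - z) \<le> r \<Longrightarrow> vabs (eval_H f x) \<le> \<zeta> (cball z r) f"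
    and disk_seminorm_le: "(\<And>x. vabs x < 1 \<Longrightarrow> vabs (x - z) \<le> r \<Longrightarrow> vabs (eval_H f x) \<le> B)
      \<Longrightarrow> \<zeta> (cball z r) f \<le> B"
    and disk_seminorm_nonneg: "0 \<le> \<zeta> (cball z r) f"
    and disk_seminorm_le_bound: "\<zeta> (cball z r) f \<le> M"
proof -
  have fH: "f \<in> H\<^sup>\<infinity>" using f H_inf_iff_coeff_bound by blast
  have cball: "x \<in> cball z r \<longleftrightarrow> vabs (x - z) \<le> r" for x
    using vabs_minus_commute[of z x] by (simp add: dist_vabs)
  have in_disk: "vabs x < 1" if "vabs (x - z) \<le> r" for x
    using vabs_add_less[of "x - z" 1 z] that z r by simp
  have bdd: "bdd_above ((\<lambda>x. vabs (eval_H f x)) ` cball z r)"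
    using vabs_eval_H_le[OF f in_disk] cball by (intro bdd_aboveI2[of _ _ M]) blast
  have zin: "z \<in> cball z r" using r by simp
  show *: "vabs (eval_H f x) \<le> \<zeta> (cball z r) f" if "vabs (x - z) \<le> r" for x
    unfolding disk_seminorm_def using fH that cball by (auto intro: cSUP_upper[OF _ bdd])
  show **: "\<zeta> (cball z r) f \<le> B"
    if "\<And>x. vabs x < 1 \<Longrightarrow> vabs (x - z) \<le> r \<Longrightarrow> vabs (eval_H f x) \<le> B" for B
    unfolding disk_seminorm_def restrict_apply'[OF fH] using zin that in_disk cball
    by (intro cSUP_least) auto
  show "0 \<le> \<zeta> (cball z r) f"
    using *[of z] vabs_nonneg[of "eval_H f z"] r by (simp del: vabs_nonneg)
  show "\<zeta> (cball z r) f \<le> M"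
    using vabs_eval_H_le[OF f] by (intro **) auto
qed


section \<open>Ultrafilters\<close>

lemma ultrafilter_refinement:
  fixes F :: "'a filter"
  assumes "F \<noteq> bot"
  shows "\<exists>G. G \<le> F \<and> G \<noteq> bot \<and> (\<forall>P. eventually P G \<or> eventually (\<lambda>x. \<not> P x) G)"
proof -
  define A where "A = {G. G \<noteq> bot \<and> G \<le> F}"
  let ?R = "\<lambda>G H. H \<le> (G :: 'a filter)"
  have "\<exists>m\<in>A. \<forall>a\<in>A. a \<le> m \<longrightarrow> a = m"
  proof (rule predicate_Zorn)
    show "partial_order_on A (relation_of ?R A)"
      by (rule partial_order_on_relation_ofI) auto
  next
    fix C assume "C \<in> Chains (relation_of ?R A)"
    then have C: "C \<subseteq> A" "\<And>G H. G \<in> C \<Longrightarrow> H \<in> C \<Longrightarrow> G \<le> H \<or> H \<le> G"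
      by (auto simp: Chains_def relation_of_def)
    show "\<exists>u\<in>A. \<forall>a\<in>C. u \<le> a"
    proof (cases "C = {}")
      case True
      then show ?thesis using assms by (auto simp: A_def)
    next
      case False
      have "eventually P (Inf C) \<longleftrightarrow> (\<exists>G\<in>C. eventually P G)" for P
        using False C(2) by (intro eventually_Inf_base) (auto simp: le_inf_iff)
      then have "Inf C \<noteq> bot"
        using C(1) unfolding A_def trivial_limit_def by auto
      moreover have "Inf C \<le> F"
        using False C(1) by (auto simp: A_def intro: Inf_lower2)
      ultimately show ?thesis by (auto simp: A_def intro: Inf_lower)
    qed
  qed
  then obtain G where G: "G \<noteq> bot" "G \<le> F"
    and min: "\<And>H. H \<noteq> bot \<Longrightarrow> H \<le> G \<Longrightarrow> H = G"
    unfolding A_def by (auto dest: order_trans)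
  have "eventually P G \<or> eventually (\<lambda>x. \<not> P x) G" for P
  proof (cases "inf G (principal {x. P x}) = bot")
    case True
    then show ?thesis
      by (simp add: trivial_limit_def eventually_inf_principal)
  next
    case False
    then have "inf G (principal {x. P x}) = G" by (rule min) simp
    moreover have "eventually P (inf G (principal {x. P x}))"
      by (simp add: eventually_inf_principal)
    ultimately show ?thesis by simp
  qed
  then show ?thesis using G by (intro exI[of _ G]) simp
qed

lemma nonprincipal_ultrafilter_neq:
  assumes "nonprincipal_ultrafilter U"
  shows "eventually (\<lambda>n. n \<noteq> m) U"
proof -
  have "\<forall>P. eventually P U \<or> eventually (\<lambda>n. \<not> P n) U" "\<not> eventually (\<lambda>n. n = m) U"
    using assms unfolding nonprincipal_ultrafilter_def by simp_all
  from spec[OF this(1), of "\<lambda>n. n = m"] this(2) show ?thesis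
    by simp
qed

lemma nonprincipal_ultrafilter_le_sequentially:
  assumes "nonprincipal_ultrafilter U"
  shows "U \<le> sequentially"
proof -
  note nonprincipal_ultrafilter_neq[OF assms]
  then have "eventually (\<lambda>n. \<forall>m\<in>{..<N}. n \<noteq> m) U" for N
    by (intro eventually_ball_finite) auto
  then have *: "eventually (\<lambda>n. N \<le> n) U" for N
    by (rule eventually_mono) (auto simp: not_less[symmetric])
  show ?thesis
  proof (rule filter_leI)
    fix P assume "eventually P sequentially"
    then obtain N where "\<And>n. N \<le> n \<Longrightarrow> P n"
      by (auto simp: eventually_sequentially)
    then show "eventually P U"
      by (rule eventually_mono[OF *])
  qed
qed

lemma bounded_tendsto_ultrafilter:
  fixes x :: "nat \<Rightarrow> real"
  assumes U: "nonprincipal_ultrafilter U" and x: "\<And>n. a \<le> x n" "\<And>n. x n \<le> b"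
  shows "(x \<longlongrightarrow> Lim U x) U"
proof -
  have Ub: "U \<noteq> bot" and ult: "\<And>P. eventually P U \<or> eventually (\<lambda>n. \<not> P n) U"
    using U by (auto simp: nonprincipal_ultrafilter_def)
  have "filtermap x U \<noteq> bot" using Ub by (simp add: filtermap_bot_iff)
  moreover have "eventually (\<lambda>y. y \<in> {a..b}) (filtermap x U)"
    using x by (simp add: eventually_filtermap)
  ultimately obtain l where l: "inf (nhds l) (filtermap x U) \<noteq> bot"
    using compact_Icc[of a b] unfolding compact_filter by meson
  have "(x \<longlongrightarrow> l) U"
  proof (rule topological_tendstoI)
    fix S assume S: "open S" "l \<in> S"
    have in_S: "eventually (\<lambda>y. y \<in> S) (inf (nhds l) (filtermap x U))"
      using S eventually_nhds_in_open filter_leD inf_le1 by metis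
    have "\<not> eventually (\<lambda>y. y \<notin> S) (filtermap x U)"
    proof
      assume "eventually (\<lambda>y. y \<notin> S) (filtermap x U)"
      then have "eventually (\<lambda>y. y \<notin> S) (inf (nhds l) (filtermap x U))"
        using filter_leD inf_le2 by metis
      with in_S have "eventually (\<lambda>_. False) (inf (nhds l) (filtermap x U))"
        by eventually_elim simp
      then show False using l by simp
    qed
    then show "eventually (\<lambda>n. x n \<in> S) U"
      using ult[of "\<lambda>n. x n \<in> S"] by (simp add: eventually_filtermap)
  qed
  then show ?thesis using tendsto_Lim[OF Ub] by metis
qed

text \<open>
  The numbers \<open>prod_encode (n, k)\<close> with \<open>k < K n\<close> are regarded as the cells of the \<open>n\<close>-th column.
  The constant \<open>C\<close> may depend on the property \<open>P\<close>; this freedom makes the sets closed under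
  intersection, since the constants simply add up.
\<close>

definition few_exceptions :: "nat filter \<Rightarrow> (nat \<Rightarrow> nat) \<Rightarrow> (nat \<Rightarrow> nat) \<Rightarrow> nat filter"
  where "few_exceptions U K L = Abs_filter (\<lambda>P. \<exists>C. \<forall>\<^sub>F n in U.
    card {k. k < K n \<and> \<not> P (prod_encode (n, k))} \<le> C * L n)"

lemma eventually_few_exceptions:
  "eventually P (few_exceptions U K L) \<longleftrightarrow>
    (\<exists>C. \<forall>\<^sub>F n in U. card {k. k < K n \<and> \<not> P (prod_encode (n, k))} \<le> C * L n)"
proof -
  let ?E = "\<lambda>P. \<exists>C. \<forall>\<^sub>F n in U. card {k. k < K n \<and> \<not> P (prod_encode (n, k))} \<le> C * L n"
  have "is_filter ?E"
  proof (rule is_filter.intro)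
    have "card {k. k < K n \<and> \<not> True} \<le> 0 * L n" for n
      by simp
    then show "\<exists>C. \<forall>\<^sub>F n in U. card {k. k < K n \<and> \<not> True} \<le> C * L n"
      by (intro exI[of _ 0] always_eventually allI)
  next
    fix P Q
    assume "\<exists>C. \<forall>\<^sub>F n in U. card {k. k < K n \<and> \<not> P (prod_encode (n, k))} \<le> C * L n"
      and "\<exists>C. \<forall>\<^sub>F n in U. card {k. k < K n \<and> \<not> Q (prod_encode (n, k))} \<le> C * L n"
    then obtain C D where
      "\<forall>\<^sub>F n in U. card {k. k < K n \<and> \<not> P (prod_encode (n, k))} \<le> C * L n"
      "\<forall>\<^sub>F n in U. card {k. k < K n \<and> \<not> Q (prod_encode (n, k))} \<le> D * L n"
      by blast
    then have "\<forall>\<^sub>F n in U. card {k. k < K n \<and> \<not> (P (prod_encode (n, k)) \<and> Q (prod_encode (n, k)))}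
        \<le> (C + D) * L n"
    proof eventually_elim
      case (elim n)
      have "{k. k < K n \<and> \<not> (P (prod_encode (n, k)) \<and> Q (prod_encode (n, k)))}
        = {k. k < K n \<and> \<not> P (prod_encode (n, k))} \<union> {k. k < K n \<and> \<not> Q (prod_encode (n, k))}"
        by auto
      then show ?case
        using elim card_Un_le[of "{k. k < K n \<and> \<not> P (prod_encode (n, k))}"
            "{k. k < K n \<and> \<not> Q (prod_encode (n, k))}"]
        by (simp add: distrib_right)
    qed
    then show "\<exists>C. \<forall>\<^sub>F n in U. card {k. k < K n \<and>
        \<not> (P (prod_encode (n, k)) \<and> Q (prod_encode (n, k)))} \<le> C * L n"
      by blast
  next
    fix P Q :: "nat \<Rightarrow> bool"
    assume PQ: "\<forall>x. P x \<longrightarrow> Q x"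
    assume "\<exists>C. \<forall>\<^sub>F n in U. card {k. k < K n \<and> \<not> P (prod_encode (n, k))} \<le> C * L n"
    then obtain C where
      "\<forall>\<^sub>F n in U. card {k. k < K n \<and> \<not> P (prod_encode (n, k))} \<le> C * L n"
      by (elim exE)
    then have "\<forall>\<^sub>F n in U. card {k. k < K n \<and> \<not> Q (prod_encode (n, k))} \<le> C * L n"
    proof eventually_elim
      case (elim n)
      have "card {k. k < K n \<and> \<not> Q (prod_encode (n, k))}
          \<le> card {k. k < K n \<and> \<not> P (prod_encode (n, k))}"
        using PQ by (intro card_mono) auto
      then show ?case using elim by (rule order_trans)
    qed
    then show "\<exists>C. \<forall>\<^sub>F n in U. card {k. k < K n \<and> \<not> Q (prod_encode (n, k))} \<le> C * L n"
      by (rule exI)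
  qed
  from eventually_Abs_filter[of ?E P, OF this] show ?thesis
    unfolding few_exceptions_def .
qed

text \<open>
  The height \<open>Suc n * L n\<close> of the columns outgrows every multiple of \<open>L n\<close>, so in a late column not
  all cells can be exceptions.
\<close>

lemma few_exceptions_neq_bot:
  assumes U: "nonprincipal_ultrafilter U" and K: "\<And>n. K n = Suc n * L n" and L: "\<And>n. 0 < L n"
  shows "few_exceptions U K L \<noteq> bot"
proof
  assume "few_exceptions U K L = bot"
  then have "eventually (\<lambda>_. False) (few_exceptions U K L)"
    by simp
  then obtain C where "\<forall>\<^sub>F n in U. K n \<le> C * L n"
    unfolding eventually_few_exceptions by auto
  moreover have "\<forall>\<^sub>F n in U. C \<le> n"
    using filter_leD[OF nonprincipal_ultrafilter_le_sequentially[OF U] eventually_ge_at_top] .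
  ultimately have "\<forall>\<^sub>F n in U. False"
  proof eventually_elim
    case (elim n)
    then have "Suc n * L n \<le> C * L n" by (simp only: K)
    then have "Suc n \<le> C" using L[of n] by (simp only: mult_le_cancel2)
    then show ?case using elim by simp
  qed
  then show False
    using U by (simp add: nonprincipal_ultrafilter_def)
qed

lemma nonprincipal_ultrafilter_below_few_exceptions:
  assumes U: "nonprincipal_ultrafilter U" and K: "\<And>n. K n = Suc n * L n" and L: "\<And>n. 0 < L n"
  obtains V where "nonprincipal_ultrafilter V" "V \<le> few_exceptions U K L"
proof -
  have "few_exceptions U K L \<noteq> bot"
    using U K L by (rule few_exceptions_neq_bot[of U K L])
  from ultrafilter_refinement[OF this]
  obtain V where V: "V \<le> few_exceptions U K L" "V \<noteq> bot"
    "\<forall>P. eventually P V \<or> eventually (\<lambda>x. \<not> P x) V"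
    by (elim exE conjE)
  have "\<not> eventually (\<lambda>i. i = m) V" for m
  proof
    assume m: "eventually (\<lambda>i. i = m) V"
    have "\<forall>\<^sub>F n in U. n \<noteq> fst (prod_decode m)"
      using U by (rule nonprincipal_ultrafilter_neq)
    then have "\<forall>\<^sub>F n in U. card {k. k < K n \<and> \<not> prod_encode (n, k) \<noteq> m} \<le> 0 * L n"
    proof eventually_elim
      case (elim n)
      then have "{k. k < K n \<and> \<not> prod_encode (n, k) \<noteq> m} = {}" by auto
      then show ?case by (metis card.empty le0)
    qed
    then have "eventually (\<lambda>i. i \<noteq> m) (few_exceptions U K L)"
      unfolding eventually_few_exceptions by (rule exI)
    then have "eventually (\<lambda>i. i \<noteq> m) V"
      by (rule filter_leD[OF V(1)])
    with m have "eventually (\<lambda>_. False) V"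
      by eventually_elim simp
    then show False using V(2) by simp
  qed
  then have "nonprincipal_ultrafilter V"
    unfolding nonprincipal_ultrafilter_def using V by simp
  then show ?thesis using V(1) by (rule that)
qed


section \<open>Limits of points are limits of disks\<close>

lemma point_seminorm_tendsto:
  fixes f :: "'a::complete_nonarch_field fps"
  assumes V: "nonprincipal_ultrafilter V" and w: "\<And>n. w n \<in> \<bbbD>" and f: "f \<in> H\<^sup>\<infinity>"
  shows "((\<lambda>n. vabs (eval_H f (w n))) \<longlongrightarrow> point_seminorm_lim w V f) V"
proof -
  have "((\<lambda>n. vabs (eval_H f (w n))) \<longlongrightarrow> Lim V (\<lambda>n. vabs (eval_H f (w n)))) V"
    using w vabs_eval_H_le[OF coeff_bound_norm_H[OF f]]
    by (intro bounded_tendsto_ultrafilter[OF V, of 0 _ "norm_H f"]) (auto simp: unit_disk_def)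
  then show ?thesis
    using f by (simp add: point_seminorm_lim_def pointwise_lim_def point_seminorm_def)
qed

lemma point_seminorm_lim_in_berkovich:
  fixes w :: "nat \<Rightarrow> 'a::complete_nonarch_field"
  assumes V: "nonprincipal_ultrafilter V" and w: "\<And>n. w n \<in> \<bbbD>"
  shows "point_seminorm_lim w V \<in> \<MM>"
proof -
  let ?\<phi> = "point_seminorm_lim w V"
  have Vb: "V \<noteq> bot" using V by (simp add: nonprincipal_ultrafilter_def)
  have w1: "vabs (w n) < 1" for n using w by (simp add: unit_disk_def)
  note lim = point_seminorm_tendsto[of V w, OF V w]
  have "?\<phi> f \<ge> 0" if "f \<in> H\<^sup>\<infinity>" for f
    by (intro tendsto_lowerbound[OF lim[OF that] _ Vb]) simp
  moreover have "?\<phi> f = undefined" if "f \<notin> H\<^sup>\<infinity>" for f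
    using that by (simp add: point_seminorm_lim_def pointwise_lim_def)
  moreover have "?\<phi> 0 = 0"
  proof (rule tendsto_unique[OF Vb _ tendsto_const])
    show "((\<lambda>n. 0) \<longlongrightarrow> ?\<phi> 0) V"
      using lim[OF H_inf_0] eval_H_const[OF w1, of 0] by simp
  qed
  moreover have "?\<phi> 1 = 1"
  proof (rule tendsto_unique[OF Vb _ tendsto_const])
    show "((\<lambda>n. 1) \<longlongrightarrow> ?\<phi> 1) V"
      using lim[OF H_inf_1] eval_H_const[OF w1, of 1] by simp
  qed
  moreover have "?\<phi> (f * g) = ?\<phi> f * ?\<phi> g" if "f \<in> H\<^sup>\<infinity>" "g \<in> H\<^sup>\<infinity>" for f g
  proof (rule tendsto_unique[OF Vb _ tendsto_mult[OF lim[OF that(1)] lim[OF that(2)]]])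
    show "((\<lambda>n. vabs (eval_H f (w n)) * vabs (eval_H g (w n))) \<longlongrightarrow> ?\<phi> (f * g)) V"
      using lim[OF H_inf_mult[OF that]] by (simp add: eval_H_mult[OF w1 that] vabs_mult)
  qed
  moreover have "?\<phi> (f + g) \<le> ?\<phi> f + ?\<phi> g" if "f \<in> H\<^sup>\<infinity>" "g \<in> H\<^sup>\<infinity>" for f g
  proof (rule tendsto_le[OF Vb tendsto_add[OF lim[OF that(1)] lim[OF that(2)]]
        lim[OF H_inf_add[OF that]]])
    have "vabs (x + y) \<le> vabs x + vabs y" for x y :: 'a
      using vabs_add[of x y] vabs_nonneg[of x] vabs_nonneg[of y] by linarith
    then show "\<forall>\<^sub>F n in V. vabs (eval_H (f + g) (w n))
        \<le> vabs (eval_H f (w n)) + vabs (eval_H g (w n))"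
      by (simp add: eval_H_add[OF w1 that])
  qed
  moreover have "?\<phi> f \<le> norm_H f" if "f \<in> H\<^sup>\<infinity>" for f
    using vabs_eval_H_le[OF coeff_bound_norm_H[OF that] w1]
    by (intro tendsto_upperbound[OF lim[OF that] _ Vb]) simp
  ultimately show ?thesis
    by (auto simp: berkovich_def)
qed

text \<open>
  Bounded power series are uniformly Lipschitz, so disks whose radii tend to \<open>0\<close> have the same limit
  as their centres.
\<close>

lemma point_seminorm_lim_in_berkovich0:
  fixes w :: "nat \<Rightarrow> 'a::complete_nonarch_field"
  assumes V: "nonprincipal_ultrafilter V" and w: "\<And>n. w n \<in> \<bbbD>"
    and w_lim: "(\<lambda>n. vabs (w n)) \<longlonglongrightarrow> 1"
  shows "point_seminorm_lim w V \<in> \<MM>\<^sub>0"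
proof -
  define r where "r n = 1 / (real n + 2)" for n
  have r: "0 < r n" "r n < 1" for n
    by (auto simp: r_def field_simps)
  have w1: "vabs (w n) < 1" for n using w by (simp add: unit_disk_def)
  have Vb: "V \<noteq> bot" using V by (simp add: nonprincipal_ultrafilter_def)
  have "r \<longlonglongrightarrow> 0"
    unfolding r_def by real_asymp
  then have rV: "(r \<longlongrightarrow> 0) V"
    using tendsto_mono nonprincipal_ultrafilter_le_sequentially[OF V] by blast
  have "Lim V (\<lambda>n. \<zeta> (cball (w n) (r n)) f) = point_seminorm_lim w V f" if f: "f \<in> H\<^sup>\<infinity>" for f
  proof -
    define M where "M = norm_H f"
    have M: "coeff_bound f M" unfolding M_def by (rule coeff_bound_norm_H[OF f])
    let ?e = "\<lambda>n. vabs (eval_H f (w n))"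
    have lower: "?e n \<le> \<zeta> (cball (w n) (r n)) f" for n
      using r[of n] by (intro vabs_eval_le_disk_seminorm[OF M w1]) auto
    have upper: "\<zeta> (cball (w n) (r n)) f \<le> ?e n + M * r n" for n
    proof (rule disk_seminorm_le[OF M w1 r])
      fix x assume x: "vabs x < 1" "vabs (x - w n) \<le> r n"
      have "vabs (eval_H f x) \<le> ?e n + vabs (eval_H f x - eval_H f (w n))"
        using vabs_diff_le_dist[of "eval_H f x" "eval_H f (w n)"] by linarith
      also have "\<dots> \<le> ?e n + M * vabs (x - w n)"
        using eval_H_lipschitz[OF M x(1) w1] by simp
      also have "\<dots> \<le> ?e n + M * r n"
        using x coeff_bound_nonneg[OF M] by (intro add_left_mono mult_left_mono) auto
      finally show "vabs (eval_H f x) \<le> ?e n + M * r n" .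
    qed
    have "((\<lambda>n. ?e n + M * r n) \<longlongrightarrow> point_seminorm_lim w V f + M * 0) V"
      by (intro tendsto_add tendsto_mult tendsto_const rV point_seminorm_tendsto[of V w, OF V w f])
    then have "((\<lambda>n. \<zeta> (cball (w n) (r n)) f) \<longlongrightarrow> point_seminorm_lim w V f) V"
      using lower upper point_seminorm_tendsto[of V w, OF V w f]
      by (intro tendsto_sandwich[of ?e "\<lambda>n. \<zeta> (cball (w n) (r n)) f" V]) simp_all
    then show ?thesis using tendsto_Lim[OF Vb] by blast
  qed
  then have "point_seminorm_lim w V = pointwise_lim V (\<lambda>n. \<zeta> (cball (w n) (r n)))"
    by (auto simp: pointwise_lim_def point_seminorm_lim_def)
  then show ?thesis
    unfolding berkovich0_def using V w w_lim r point_seminorm_lim_in_berkovich[of V w, OF V w] by blast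
qed


section \<open>Limits of disks are limits of points\<close>

text \<open>
  Few of the separated points can be bad for \<open>f\<close>: enough bad points would make \<open>f\<close> small on the whole
  disk.  Separation close to the radius makes the interpolation constants \<open>\<rho>\<^bsup>-K\<^esup>\<close> harmless, and
  the remainder \<open>r\<^sup>N M\<close> sets the number of bad points that can be tolerated.
\<close>

lemma few_bad_points:
  fixes f :: "'a::complete_nonarch_field fps" and p :: "nat \<Rightarrow> 'a"
  assumes f: "coeff_bound f M" and z: "vabs z < 1" and r: "0 < r" "r < 1"
    and \<rho>: "0 < \<rho>" "\<rho> < 1" "q \<le> \<rho> ^ K"
    and p: "\<And>i. i < K \<Longrightarrow> vabs (p i - z) \<le> r"
    and sep: "\<And>i j. i < K \<Longrightarrow> j < K \<Longrightarrow> i \<noteq> j \<Longrightarrow> \<rho> * r \<le> vabs (p i - p j)"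
    and c: "0 \<le> c" "c < \<zeta> (cball z r) f" and N: "M * r ^ N \<le> c"
  shows "card {k. k < K \<and> vabs (eval_H f (p k)) \<le> q * c} \<le> N"
proof (rule ccontr)
  define B where "B = {k. k < K \<and> vabs (eval_H f (p k)) \<le> q * c}"
  assume "\<not> card {k. k < K \<and> vabs (eval_H f (p k)) \<le> q * c} \<le> N"
  then have BN: "N \<le> card B" by (simp add: B_def)
  have finB: "finite B" by (simp add: B_def)
  have BK: "card B \<le> K"
    using card_mono[of "{..<K}" B] by (auto simp: B_def)
  have inj: "inj_on p B"
  proof (rule inj_onI, rule ccontr)
    fix i j assume ij: "i \<in> B" "j \<in> B" "p i = p j" "i \<noteq> j"
    then have "\<rho> * r \<le> 0" using sep[of i j] by (simp add: B_def)
    then show False using \<rho> r by (simp add: mult_le_0_iff)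
  qed
  have in_disk: "vabs (p i) < 1" if "i < K" for i
    using vabs_add_less[of "p i - z" 1 z] p[OF that] z r by simp
  have "\<zeta> (cball z r) f \<le> c"
  proof (rule disk_seminorm_le[OF f z r])
    fix x assume x: "vabs x < 1" "vabs (x - z) \<le> r"
    have *: "vabs (x - p i) \<le> r" if "i < K" for i
      using vabs_diff_le[OF x(2) p[OF that]] by simp
    have qc: "q * c \<le> \<rho> ^ card B * c"
    proof (rule mult_right_mono[OF _ c(1)])
      have "\<rho> ^ K \<le> \<rho> ^ card B" using \<rho> BK by (intro power_decreasing) auto
      then show "q \<le> \<rho> ^ card B" using \<rho>(3) by linarith
    qed
    have "vabs (eval_H f x) \<le> max ((r / (\<rho> * r)) ^ card (p ` B) * (\<rho> ^ card B * c))
        (r ^ card (p ` B) * M)"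
    proof (rule small_at_separated_points_imp_small[OF _ f])
      show "\<rho> * r \<le> r" using \<rho> r by simp
      show "\<rho> * r \<le> vabs (t - t')" if "t \<in> p ` B" "t' \<in> p ` B" "t \<noteq> t'" for t t'
        using that sep by (auto simp: B_def)
      show "vabs (eval_H f t) \<le> \<rho> ^ card B * c" if "t \<in> p ` B" for t
        using that qc by (auto simp: B_def)
    qed (use finB \<rho> r c x * in_disk in \<open>auto simp: B_def\<close>)
    also have "\<dots> = max c (r ^ card B * M)"
      using \<rho> r by (simp add: card_image[OF inj] power_divide power_mult_distrib)
    also have "\<dots> \<le> c"
    proof -
      have "r ^ card B * M \<le> r ^ N * M"
        using r BN coeff_bound_nonneg[OF f] by (intro mult_right_mono power_decreasing) auto
      then show ?thesis using N by (simp add: mult.commute)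
    qed
    finally show "vabs (eval_H f x) \<le> c" .
  qed
  then show False using c by simp
qed

text \<open>
  From above, the seminorm of the disk bounds \<open>\<bar>f\<bar>\<close> without exceptions.  From below, a threshold
  \<open>b > 0\<close> under the limit tolerates \<open>C * L n\<close> exceptions as soon as \<open>M * (1/2)\<^sup>C \<le> b\<close>, a condition
  on \<open>C\<close> that does not involve \<open>n\<close>.
\<close>

lemma tendsto_few_exceptions:
  fixes f :: "'a::complete_nonarch_field fps" and p :: "nat \<Rightarrow> nat \<Rightarrow> 'a"
  assumes U: "nonprincipal_ultrafilter U" and f: "coeff_bound f M"
    and z: "\<And>n. vabs (z n) < 1" and r: "\<And>n. 0 < r n" "\<And>n. r n < 1"
    and L: "\<And>n. r n ^ L n \<le> 1 / 2"
    and \<rho>: "\<And>n. 0 < \<rho> n" "\<And>n. \<rho> n < 1" "\<And>n. q n \<le> \<rho> n ^ K n" and q: "q \<longlonglongrightarrow> 1"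
    and p: "\<And>n i. i < K n \<Longrightarrow> vabs (p n i - z n) \<le> r n"
    and sep: "\<And>n i j. i < K n \<Longrightarrow> j < K n \<Longrightarrow> i \<noteq> j \<Longrightarrow> \<rho> n * r n \<le> vabs (p n i - p n j)"
    and W: "\<And>n k. k < K n \<Longrightarrow> W (prod_encode (n, k)) = p n k"
    and lim: "((\<lambda>n. \<zeta> (cball (z n) (r n)) f) \<longlongrightarrow> c) U"
  shows "((\<lambda>m. vabs (eval_H f (W m))) \<longlongrightarrow> c) (few_exceptions U K L)"
proof (rule order_tendstoI)
  fix a assume a: "c < a"
  have "\<forall>\<^sub>F n in U. \<zeta> (cball (z n) (r n)) f < a"
    using order_tendstoD(2)[OF lim a] .
  then have "\<forall>\<^sub>F n in U.
      card {k. k < K n \<and> \<not> vabs (eval_H f (W (prod_encode (n, k)))) < a} \<le> 0 * L n"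
  proof eventually_elim
    case (elim n)
    have "vabs (eval_H f (p n k)) < a" if "k < K n" for k
      using vabs_eval_le_disk_seminorm[OF f z r p[OF that]] elim by (rule le_less_trans)
    then have "{k. k < K n \<and> \<not> vabs (eval_H f (W (prod_encode (n, k)))) < a} = {}"
      using W by auto
    then show ?case by (metis card.empty le0)
  qed
  then show "\<forall>\<^sub>F m in few_exceptions U K L. vabs (eval_H f (W m)) < a"
    unfolding eventually_few_exceptions by (rule exI)
next
  fix a assume a: "a < c"
  show "\<forall>\<^sub>F m in few_exceptions U K L. a < vabs (eval_H f (W m))"
  proof (cases "a < 0")
    case True
    then have "a < vabs x" for x :: 'a by (rule less_le_trans) simp
    then show ?thesis by simp
  next
    case False
    obtain b where b: "a < b" "b < c" using dense[OF a] by blast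
    have b0: "0 < b" using False b by simp
    have M: "0 \<le> M" using coeff_bound_nonneg[OF f] .
    obtain C where C: "(1 / 2) ^ C < b / (M + 1)"
      using real_arch_pow_inv[of "b / (M + 1)" "1 / 2"] b0 M by auto
    have MC: "M * r n ^ (C * L n) \<le> b" for n
    proof -
      have "r n ^ (C * L n) = (r n ^ L n) ^ C"
        by (simp add: power_mult[symmetric] mult.commute)
      also have "\<dots> \<le> (1 / 2) ^ C"
        using L[of n] r(1)[of n] by (intro power_mono) auto
      also have "\<dots> \<le> b / (M + 1)" using C by simp
      finally have "M * r n ^ (C * L n) \<le> (M + 1) * (b / (M + 1))"
        using M r(1)[of n] by (intro mult_mono) auto
      then show ?thesis using M by simp
    qed
    have "(\<lambda>n. q n * b) \<longlonglongrightarrow> 1 * b"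
      by (intro tendsto_mult q tendsto_const)
    then have "\<forall>\<^sub>F n in sequentially. a < q n * b"
      using b order_tendstoD(1) by fastforce
    then have "\<forall>\<^sub>F n in U. a < q n * b"
      using filter_leD[OF nonprincipal_ultrafilter_le_sequentially[OF U]] by blast
    moreover have "\<forall>\<^sub>F n in U. b < \<zeta> (cball (z n) (r n)) f"
      using order_tendstoD(1)[OF lim b(2)] .
    ultimately have "\<forall>\<^sub>F n in U.
        card {k. k < K n \<and> \<not> a < vabs (eval_H f (W (prod_encode (n, k))))} \<le> C * L n"
    proof eventually_elim
      case (elim n)
      have "card {k. k < K n \<and> \<not> a < vabs (eval_H f (W (prod_encode (n, k))))}
          \<le> card {k. k < K n \<and> vabs (eval_H f (p n k)) \<le> q n * b}"
        using elim W by (intro card_mono) auto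
      also have "\<dots> \<le> C * L n"
        using elim b0 MC[of n]
        by (intro few_bad_points[of f M "z n" "r n" "\<rho> n" "q n" "K n" "p n" b "C * L n",
              OF f z r \<rho> p sep]) simp_all
      finally show ?case .
    qed
    then show ?thesis
      unfolding eventually_few_exceptions by (rule exI)
  qed
qed

text \<open>
  The choices: \<open>L n\<close> is large enough for \<open>r n ^ L n \<le> 1 / 2\<close>, the column height \<open>K n\<close> is \<open>Suc n * L n\<close>,
  and the relative separation \<open>\<rho> n\<close> is so close to 1 that even its \<open>K n\<close>-th power tends to 1.
\<close>

lemma disk_seminorm_lim_is_point_seminorm_lim:
  fixes z :: "nat \<Rightarrow> 'a::complete_nonarch_field"
  assumes U: "nonprincipal_ultrafilter U" and z: "\<And>n. vabs (z n) < 1"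
    and z_lim: "(\<lambda>n. vabs (z n)) \<longlonglongrightarrow> 1" and r: "\<And>n. 0 < r n" "\<And>n. r n < 1"
  shows "\<exists>W V. pointwise_lim U (\<lambda>n. \<zeta> (cball (z n) (r n))) = point_seminorm_lim W V \<and>
    (\<forall>m. W m \<in> \<bbbD>) \<and> (\<lambda>m. vabs (W m)) \<longlonglongrightarrow> 1 \<and> nonprincipal_ultrafilter V"
proof -
  have "\<exists>l. 0 < l \<and> r n ^ l \<le> 1 / 2" for n
  proof -
    obtain l where l: "r n ^ l < 1 / 2"
      using real_arch_pow_inv[of "1 / 2" "r n"] r by auto
    then have "0 < l" by (cases l) auto
    then show ?thesis using l by (auto intro: less_imp_le)
  qed
  then obtain L where L: "\<And>n. 0 < L n" "\<And>n. r n ^ L n \<le> 1 / 2"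
    by metis
  define K where "K n = Suc n * L n" for n
  have K: "0 < K n" for n using L by (simp add: K_def)
  \<comment> \<open>By Bernoulli's inequality the \<open>K n\<close>-th power of \<open>\<rho> n\<close> is at least \<open>q n\<close>.\<close>
  define q where "q n = 1 - 1 / (real n + 2)" for n
  define \<rho> where "\<rho> n = 1 - 1 / ((real n + 2) * real (K n))" for n
  have K1: "1 \<le> real (K n)" for n using K[of n] by linarith
  have pos: "1 < (real n + 2) * real (K n)" for n
    using mult_mono[of 2 "real n + 2" 1 "real (K n)"] K1[of n] by simp
  have \<rho>: "0 < \<rho> n" "\<rho> n < 1" for n
    using pos[of n] K1[of n] by (auto simp: \<rho>_def field_simps)
  have q\<rho>: "q n \<le> \<rho> n ^ K n" for n
  proof -
    have "1 + real (K n) * (- (1 / ((real n + 2) * real (K n))))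
        \<le> (1 + (- (1 / ((real n + 2) * real (K n))))) ^ K n"
      using pos[of n] by (intro Bernoulli_inequality) (simp add: field_simps)
    moreover have "real (K n) * (- (1 / ((real n + 2) * real (K n)))) = - (1 / (real n + 2))"
      using K1[of n] by simp
    ultimately show ?thesis
      by (simp add: q_def \<rho>_def)
  qed
  have q: "q \<longlonglongrightarrow> 1"
    unfolding q_def by real_asymp
  have "\<rho> n ^ K n \<le> \<rho> n ^ 1" for n
    using \<rho>[of n] K[of n] by (intro power_decreasing) auto
  then have q\<rho>1: "q n \<le> \<rho> n" for n
    using q\<rho>[of n] by (metis order_trans power_one_right)
  let ?good = "\<lambda>n p.
    (\<forall>i<K n. vabs (p i - z n) \<le> r n \<and> vabs (p i) < 1 \<and> \<rho> n * vabs (z n) \<le> vabs (p i)) \<and>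
    (\<forall>i<K n. \<forall>j<K n. i \<noteq> j \<longrightarrow> \<rho> n * r n \<le> vabs (p i - p j))"
  have "\<forall>n. \<exists>p. ?good n p"
  proof
    fix n
    show "\<exists>p. ?good n p"
    proof (rule separated_points_in_disk[of "z n" "r n" "\<rho> n" "K n", OF z r \<rho>])
      fix p
      assume "\<And>i. i < K n \<Longrightarrow> vabs (p i - z n) \<le> r n" "\<And>i. i < K n \<Longrightarrow> vabs (p i) < 1"
        "\<And>i. i < K n \<Longrightarrow> \<rho> n * vabs (z n) \<le> vabs (p i)"
        "\<And>i j. i < K n \<Longrightarrow> j < K n \<Longrightarrow> i \<noteq> j \<Longrightarrow> \<rho> n * r n \<le> vabs (p i - p j)"
      then show ?thesis by (intro exI[of _ p]) simp
    qed
  qed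
  then have "\<exists>p. \<forall>n. ?good n (p n)"
    by (rule choice)
  then obtain p where "\<forall>n. ?good n (p n)"
    by (elim exE)
  then have p: "\<And>n i. i < K n \<Longrightarrow> vabs (p n i - z n) \<le> r n"
    "\<And>n i. i < K n \<Longrightarrow> vabs (p n i) < 1"
    "\<And>n i. i < K n \<Longrightarrow> \<rho> n * vabs (z n) \<le> vabs (p n i)"
    "\<And>n i j. i < K n \<Longrightarrow> j < K n \<Longrightarrow> i \<noteq> j \<Longrightarrow> \<rho> n * r n \<le> vabs (p n i - p n j)"
    by simp_all
  \<comment> \<open>Codes \<open>(n, k)\<close> with \<open>k \<ge> K n\<close> carry filler points, chosen so that \<open>\<bar>W m\<bar>\<close> still tends to 1.\<close>
  define W where "W m = (case prod_decode m of (n, k) \<Rightarrow> if k < K n then p n k else z m)" for m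
  have W: "W (prod_encode (n, k)) = p n k" if "k < K n" for n k
    using that by (simp add: W_def)
  have W1: "vabs (W m) < 1" for m
    using p(2) z by (auto simp: W_def split: prod.split)
  have W_lim: "(\<lambda>m. vabs (W m)) \<longlonglongrightarrow> 1"
  proof (rule order_tendstoI)
    fix a :: real assume a: "a < 1"
    have "(\<lambda>n. q n * vabs (z n)) \<longlonglongrightarrow> 1"
      using tendsto_mult[OF q z_lim] by simp
    from order_tendstoD(1)[OF this a]
    obtain n0 where n0: "\<And>n. n0 \<le> n \<Longrightarrow> a < q n * vabs (z n)"
      by (auto simp: eventually_sequentially)
    have good: "a < vabs (p n k)" if "k < K n" "n0 \<le> n" for n k
    proof -
      have "q n * vabs (z n) \<le> \<rho> n * vabs (z n)"
        using q\<rho>1 by (intro mult_right_mono) auto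
      then show ?thesis using n0[OF that(2)] p(3)[OF that(1)] by linarith
    qed
    obtain m0 where m0: "\<And>m. m0 \<le> m \<Longrightarrow> a < vabs (z m)"
      using order_tendstoD(1)[OF z_lim a] by (auto simp: eventually_sequentially)
    \<comment> \<open>The columns before \<open>n0\<close> are finite, so only finitely many codes are discarded.\<close>
    define X where "X = {..<m0} \<union> prod_encode ` (SIGMA n:{..<n0}. {..<K n})"
    have "finite X" by (simp add: X_def)
    then have "\<forall>\<^sub>F m in sequentially. m \<notin> X"
      by (simp add: eventually_cofinite flip: cofinite_eq_sequentially)
    then show "\<forall>\<^sub>F m in sequentially. a < vabs (W m)"
    proof (rule eventually_mono)
      fix m assume m: "m \<notin> X"
      obtain n k where nk: "m = prod_encode (n, k)"
        by (metis prod_decode_inverse surj_pair)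
      show "a < vabs (W m)"
      proof (cases "k < K n")
        case True
        then have "n0 \<le> n" using m nk by (auto simp: X_def not_less[symmetric])
        then show ?thesis using good True W nk by simp
      next
        case False
        then have "W m = z m" by (simp add: W_def nk)
        then show ?thesis using m m0 by (simp add: X_def)
      qed
    qed
  next
    fix a :: real assume "1 < a"
    then have "vabs (W m) < a" for m using W1[of m] by linarith
    then show "\<forall>\<^sub>F m in sequentially. vabs (W m) < a" by simp
  qed
  obtain V where V: "nonprincipal_ultrafilter V" "V \<le> few_exceptions U K L"
    using nonprincipal_ultrafilter_below_few_exceptions[of U K L, OF U K_def L(1)] by blast
  have Vb: "V \<noteq> bot" using V by (simp add: nonprincipal_ultrafilter_def)
  have "Lim U (\<lambda>n. \<zeta> (cball (z n) (r n)) f) = Lim V (\<lambda>m. vabs (eval_H f (W m)))"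
    if f: "f \<in> H\<^sup>\<infinity>" for f
  proof -
    note M = coeff_bound_norm_H[OF f]
    have "((\<lambda>n. \<zeta> (cball (z n) (r n)) f) \<longlongrightarrow> Lim U (\<lambda>n. \<zeta> (cball (z n) (r n)) f)) U"
      using disk_seminorm_nonneg[OF M z r] disk_seminorm_le_bound[OF M z r]
      by (rule bounded_tendsto_ultrafilter[OF U,
            of 0 "\<lambda>n. \<zeta> (cball (z n) (r n)) f" "norm_H f"])
    note lim = this
    have "((\<lambda>m. vabs (eval_H f (W m))) \<longlongrightarrow> Lim U (\<lambda>n. \<zeta> (cball (z n) (r n)) f))
        (few_exceptions U K L)"
      by (rule tendsto_few_exceptions[of U f "norm_H f" z r L \<rho> q K p W,
            OF U M z r L(2) \<rho> q\<rho> q])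
        (rule p(1,4) W lim; assumption)+
    from tendsto_Lim[OF Vb tendsto_mono[OF V(2) this]] show ?thesis
      by (rule sym)
  qed
  then have "pointwise_lim U (\<lambda>n. \<zeta> (cball (z n) (r n))) = point_seminorm_lim W V"
    by (auto simp: pointwise_lim_def point_seminorm_lim_def point_seminorm_def)
  then show ?thesis
    using W1 W_lim V(1) by (intro exI[of _ W] exI[of _ V]) (simp add: unit_disk_def)
qed

theorem theorem2p3:
  shows "(\<MM>\<^sub>0 :: ('a::complete_nonarch_field fps \<Rightarrow> real) set) =
    {point_seminorm_lim w V | w V.
      (\<forall>n. w n \<in> \<bbbD>) \<and> (\<lambda>n. vabs (w n)) \<longlonglongrightarrow> 1 \<and> nonprincipal_ultrafilter V}"
proof (intro subset_antisym subsetI)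
  fix \<phi> :: "'a fps \<Rightarrow> real"
  assume "\<phi> \<in> \<MM>\<^sub>0"
  then obtain U z r where *: "nonprincipal_ultrafilter U" "\<forall>n. z n \<in> \<bbbD>"
    "(\<lambda>n. vabs (z n)) \<longlonglongrightarrow> 1" "\<forall>n. 0 < r n \<and> r n < 1"
    and \<phi>: "\<phi> = pointwise_lim U (\<lambda>n. \<zeta> (cball (z n) (r n)))"
    unfolding berkovich0_def by (elim CollectE exE conjE)
  have z: "vabs (z n) < 1" and r: "0 < r n" "r n < 1" for n
    using *(2,4) by (simp_all add: unit_disk_def)
  from disk_seminorm_lim_is_point_seminorm_lim[of U z r, OF *(1) z *(3) r]
  show "\<phi> \<in> {point_seminorm_lim w V | w V.
      (\<forall>n. w n \<in> \<bbbD>) \<and> (\<lambda>n. vabs (w n)) \<longlonglongrightarrow> 1 \<and> nonprincipal_ultrafilter V}"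
    unfolding \<phi> by (intro CollectI)
next
  fix \<phi> :: "'a fps \<Rightarrow> real"
  assume "\<phi> \<in> {point_seminorm_lim w V | w V.
      (\<forall>n. w n \<in> \<bbbD>) \<and> (\<lambda>n. vabs (w n)) \<longlonglongrightarrow> 1 \<and> nonprincipal_ultrafilter V}"
  then show "\<phi> \<in> \<MM>\<^sub>0"
    by (elim CollectE exE conjE) (simp add: point_seminorm_lim_in_berkovich0)
qed

end
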